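(* Let $n\ge1$ and $0<d\le n-1$ be integers, let $\mu=\frac{a\,\Delta t}{(\Delta x)^2}$ with $a,\Delta t,\Delta x>0$ real, and let $\mathbf{T}_n=\mathrm{tridiag}(\mu,-2\mu,\mu)\in\mathbb{R}^{n\times n}$. Let $\mathbf{U}_0\in\mathbb{R}^n$ be the initial vector, and let $\mathbf{U}^{(k,d)}$ be the vector obtained at the $k$-th step ($k\ge1$) of the method $$\mathbf{U}^{(0,d)}=\mathbf{U}_0,\qquad \mathbf{U}^{(k,d)}=\Psi^{[d]}(\mathbf{T}_n)\,\mathbf{U}^{(k-1,d)},\quad k\ge1.$$ Then $$\|\mathbf{U}^{(k,d)}\|_{\infty}<\|\mathbf{U}_0\|_{\infty}.$$ In other words, the method preserves the maximum principle unconditionally.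
   Context: The method arises from the heat equation $u_t=au_{xx}$, $a>0$, on an interval $[b,c]$ with homogeneous Dirichlet boundary conditions and initial condition $u(x,0)=u_0(x)$, discretized by central differences at the points $x_j=b+j\Delta x$, $j=1,\dots,n$, $\Delta x=\frac{c-b}{n+1}$, with time step $\Delta t>0$; the initial vector is $\mathbf{U}_0=(u_0(x_1),\dots,u_0(x_n))^T$, and $\mathbf{U}^{(k,d)}$ approximates the solution at the grid points at time $k\Delta t$. The maximum principle for the heat equation is the fact that $u(x,t)$ is bounded above and below by the extremes attained by the initial data and the boundary values up to time $t$. $\mathrm{tridiag}(\mu,-2\mu,\mu)$ is the $n\times n$ tridiagonal Toeplitz matrix with $-2\mu$ on the main diagonal, $\mu$ on the sub- and super-diagonals, and zeros elsewhere. For a vector, $\|\cdot\|_\infty$ is the maximum absolute value of its entries. For an integer $m\ge 0$, $I_m(x)=\sum_{s=0}^{\infty}\frac{1}{s!(m+s)!}\left(\frac{x}{2}\right)^{m+2s}$ is the modified Bessel function of the first kind. For a vector $\mathbf{u}$ of length $n$, $\mathrm{Toeplitz}\{\mathbf{u}\}$ is the $n\times n$ Toeplitz matrix whose first column and first row are both $\mathbf{u}$. For a vector $\mathbf{v}=(v_1,\dots,v_n)$, $\mathrm{Hankel}\{\mathbf{v}\}$ is the $n\times n$ Hankel matrix whose first column is $\mathbf{v}$ and whose last row is the reversal of $\mathbf{v}$; that is, its $(i,j)$ entry is $v_{i+j-1}$ if $i+j\le n+1$ and $v_{2n+1-i-j}$ otherwise. The matrix $\Psi^{[d]}(\mathbf{T}_n)$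 is defined by $\Psi^{[d]}(\mathbf{T}_n)=\mathrm{Toeplitz}\{\mathbf{u}^{[d]}\}-\mathrm{Hankel}\{\mathbf{v}^{[d]}\}$, where $\mathbf{u}^{[d]}$ and $\mathbf{v}^{[d]}$ are the vectors of length $n$ given by $\mathbf{u}^{[d]}=(e^{-2\mu}I_0(2\mu),e^{-2\mu}I_1(2\mu),\dots,e^{-2\mu}I_d(2\mu),0,\dots,0)$ and $\mathbf{v}^{[d]}=(e^{-2\mu}I_2(2\mu),e^{-2\mu}I_3(2\mu),\dots,e^{-2\mu}I_{d+2}(2\mu),0,\dots,0)$.
   Formalization: The strict inequality is stated for nonzero initial vectors U_0 only, since for U_0 = 0 it would read 0 < 0; the maximum principle (bounds by the extremes of the initial values and the boundary value 0) is stated for every U_0. *)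

theory Defs
  imports "HOL-Analysis.Analysis" "Jordan_Normal_Form.Matrix"
begin

(* Vectors and matrices are indexed from 0, so the (i, j) entry of the
   mathematical text is the entry (i - 1, j - 1) here. *)

definition bessel_I :: "nat \<Rightarrow> real \<Rightarrow> real" where
  "bessel_I m x = (\<Sum>s. 1 / (fact s * fact (m + s)) * (x / 2) ^ (m + 2 * s))"

lemma summable_bessel_I:
  fixes x :: real
  shows "summable (\<lambda>s. 1 / (fact s * fact (m + s)) * (x / 2) ^ (m + 2 * s))"
proof (rule summable_comparison_test')
  let ?y = "\<bar>x / 2\<bar>"
  show "summable (\<lambda>s. ?y ^ m * (inverse (fact s) * (?y ^ 2) ^ s))"
    by (intro summable_mult summable_exp)
  fix s :: nat
  have "1 / (fact s * fact (m + s)) \<le> (1 / fact s :: real)"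
    by (simp add: field_simps)
  then have "1 / (fact s * fact (m + s)) * ?y ^ (m + 2 * s) \<le> (1 / fact s) * ?y ^ (m + 2 * s)"
    by (intro mult_right_mono) auto
  also have "\<dots> = ?y ^ m * (inverse (fact s) * (?y ^ 2) ^ s)"
    unfolding power_add power_mult inverse_eq_divide by (simp only: mult_ac)
  finally have bound: "1 / (fact s * fact (m + s)) * ?y ^ (m + 2 * s)
      \<le> ?y ^ m * (inverse (fact s) * (?y ^ 2) ^ s)" .
  have "norm (1 / (fact s * fact (m + s)) * (x / 2) ^ (m + 2 * s))
      = 1 / (fact s * fact (m + s)) * ?y ^ (m + 2 * s)"
    unfolding real_norm_def abs_mult power_abs by simp
  with bound show "norm (1 / (fact s * fact (m + s)) * (x / 2) ^ (m + 2 * s))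
      \<le> ?y ^ m * (inverse (fact s) * (?y ^ 2) ^ s)"
    by (simp only:)
qed

definition tridiag :: "nat \<Rightarrow> real \<Rightarrow> real \<Rightarrow> real \<Rightarrow> real mat" where
  "tridiag n lo di up = mat n n (\<lambda>(i, j).
     if i = j then di else if i = j + 1 then lo else if j = i + 1 then up else 0)"

definition toeplitz :: "real vec \<Rightarrow> real mat" where
  "toeplitz u = mat (dim_vec u) (dim_vec u) (\<lambda>(i, j). u $ (if i \<le> j then j - i else i - j))"

(* With 1-based i, j the entry is v_(i+j-1) if i + j <= n + 1 and v_(2n+1-i-j)
   otherwise; shifting all three indices by one gives the formula below. *)
definition hankel :: "real vec \<Rightarrow> real mat" where
  "hankel v = (let n = dim_vec v in
     mat n n (\<lambda>(i, j). v $ (if i + j < n then i + j else 2 * n - 2 - i - j)))"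

definition u_vec :: "nat \<Rightarrow> nat \<Rightarrow> real \<Rightarrow> real vec" where
  "u_vec n d \<mu> = vec n (\<lambda>i. if i \<le> d then exp (- 2 * \<mu>) * bessel_I i (2 * \<mu>) else 0)"

definition v_vec :: "nat \<Rightarrow> nat \<Rightarrow> real \<Rightarrow> real vec" where
  "v_vec n d \<mu> = vec n (\<lambda>i. if i \<le> d then exp (- 2 * \<mu>) * bessel_I (i + 2) (2 * \<mu>) else 0)"

(* Psi is only meant for T = tridiag n mu (-2 mu) mu; the parameters n and mu are
   recovered from T as its dimension and from its diagonal entry, see Psi_tridiag. *)
definition Psi :: "nat \<Rightarrow> real mat \<Rightarrow> real mat" where
  "Psi d T = (let n = dim_row T; \<mu> = - (T $$ (0, 0)) / 2 in
     toeplitz (u_vec n d \<mu>) - hankel (v_vec n d \<mu>))"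

lemma Psi_tridiag:
  assumes "n \<ge> 1"
  shows "Psi d (tridiag n \<mu> (- 2 * \<mu>) \<mu>) = toeplitz (u_vec n d \<mu>) - hankel (v_vec n d \<mu>)"
  using assms by (simp add: Psi_def tridiag_def)

primrec method_step :: "nat \<Rightarrow> real mat \<Rightarrow> real vec \<Rightarrow> nat \<Rightarrow> real vec" where
  "method_step d T U0 0 = U0"
| "method_step d T U0 (Suc k) = Psi d T *\<^sub>v method_step d T U0 k"

definition linf_norm :: "real vec \<Rightarrow> real" where
  "linf_norm v = Max ((\<lambda>i. \<bar>v $ i\<bar>) ` {..<dim_vec v})"

(* Discrete maximum principle relative to initial data U0 and homogeneous Dirichlet
   conditions: the 0 adjoined to the initial values is the boundary value. *)
definition within_data_extremes :: "real vec \<Rightarrow> real vec \<Rightarrow> bool" where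
  "within_data_extremes U0 U \<longleftrightarrow>
     (\<forall>i < dim_vec U. Min (insert 0 (set\<^sub>v U0)) \<le> U $ i \<and> U $ i \<le> Max (insert 0 (set\<^sub>v U0)))"

end

(* The entries of Psi are differences of Bessel values whose orders have the same
   parity, so they are nonnegative already by I_{m+2} <= I_m, which follows by comparing
   the two series term by term after a shift by one.  Since exp (2 mu) is the sum of
   I_|m|(2 mu) over all integers m, every row sum is strictly below 1.  A nonnegative
   matrix with row sums below 1 contracts the maximum norm strictly and keeps every
   interval that contains 0. *)
theory Submission
  imports Defs
begin

section \<open>Inequalities for modified Bessel functions\<close>

lemma bessel_I_nonneg:
  assumes "x \<ge> 0"
  shows "bessel_I m x \<ge> 0"
  unfolding bessel_I_def using assms by (intro suminf_nonneg summable_bessel_I) auto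

lemma bessel_I_add_2_le:
  assumes "x \<ge> 0"
  shows "bessel_I (m + 2) x \<le> bessel_I m x"
proof -
  let ?t = "\<lambda>m s. 1 / (fact s * fact (m + s)) * (x / 2) ^ (m + 2 * s)"
  have term_le: "?t (m + 2) s \<le> ?t m (Suc s)" for s
  proof -
    \<comment> \<open>After cancelling \<open>fact s * fact (m + Suc s)\<close> this is
      \<open>s + 1 \<le> m + 2 + s\<close>.\<close>
    have "fact (Suc s) * fact (m + Suc s) \<le> (fact s * fact (m + 2 + s) :: real)"
      by (simp add: mult.assoc mult.left_commute mult_left_mono algebra_simps)
    then have "1 / (fact s * fact (m + 2 + s)) \<le> (1 / (fact (Suc s) * fact (m + Suc s)) :: real)"
      by (intro divide_left_mono mult_pos_pos fact_gt_zero) auto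
    moreover have "m + 2 + 2 * s = m + 2 * Suc s"
      by simp
    ultimately show ?thesis
      using assms by (metis mult_right_mono zero_le_power divide_nonneg_nonneg zero_le_numeral)
  qed
  have "bessel_I (m + 2) x \<le> (\<Sum>s. ?t m (Suc s))"
    unfolding bessel_I_def
    by (intro suminf_le term_le summable_bessel_I summable_Suc_iff[THEN iffD2])
  also have "\<dots> = bessel_I m x - ?t m 0"
    unfolding bessel_I_def by (rule suminf_split_head[OF summable_bessel_I])
  also have "\<dots> \<le> bessel_I m x"
    using assms by simp
  finally show ?thesis .
qed

lemma bessel_I_add_even_le:
  assumes "x \<ge> 0"
  shows "bessel_I (m + 2 * r) x \<le> bessel_I m x"
proof (induction r)
  case (Suc r)
  then show ?case
    using bessel_I_add_2_le[OF assms, of "m + 2 * r"] by simp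
qed simp

text \<open>Stated for partial sums so that a product of two exponential series can be handled on
  finite squares of indices.\<close>

lemma sum_power_fact_le_exp:
  fixes y :: real
  assumes "y \<ge> 0"
  shows "(\<Sum>a<N. y ^ a / fact a) \<le> exp y"
proof -
  have "(\<lambda>a. y ^ a / fact a) sums exp y"
    using exp_converges[of y] by (simp add: divide_inverse mult.commute)
  then show ?thesis
    using assms by (intro sum_le_suminf[THEN order_trans, of _ _ "exp y"])
      (auto simp: sums_iff)
qed

text \<open>With \<open>y = x / 2\<close>, expand \<open>exp x = exp y * exp y\<close> into a double
  series of positive terms. Collecting the terms whose exponents differ by q yields the Bessel
  function of order |q|. A row meets only the n differences \<open>j - i\<close>, each once, so part
  of the double series is left over.\<close>

lemma sum_bessel_I_less_exp:
  fixes x :: real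
  assumes "x > 0" and "i < n"
  shows "(\<Sum>j<n. bessel_I ((j - i) + (i - j)) x) < exp x"
proof -
  define y where "y = x / 2"
  have "y > 0"
    using assms by (simp add: y_def)
  let ?e = "\<lambda>a. y ^ a / fact a"
  let ?t = "\<lambda>m s. 1 / (fact s * fact (m + s)) * (x / 2) ^ (m + 2 * s)"
  \<comment> \<open>The term of order \<open>\<bar>i - j\<bar>\<close> and index \<open>s\<close> is the product of the terms \<open>a\<close> and \<open>b\<close> of the
    series of \<open>exp y\<close> with \<open>a - b = j - i\<close> and \<open>min a b = s\<close>; truncated subtraction gives both
    signs of \<open>j - i\<close> at once.\<close>
  define g where "g = (\<lambda>(j, s). ((j - i) + s, (i - j) + s))"
  have term_eq: "?t ((j - i) + (i - j)) s = (case g (j, s) of (a, b) \<Rightarrow> ?e a * ?e b)" for j s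
  proof -
    have order: "(j - i) + (i - j) + 2 * s = ((j - i) + s) + ((i - j) + s)"
      by simp
    have "fact s * fact ((j - i) + (i - j) + s)
        = (fact ((j - i) + s) * fact ((i - j) + s) :: real)"
      by (cases "j \<le> i") simp_all
    then show ?thesis
      unfolding order power_add[of _ "(j - i) + s"] y_def[symmetric] g_def by simp
  qed
  have "inj g"
    by (auto simp: g_def inj_on_def)
  then have inj: "inj_on g ({..<n} \<times> {..<M})" for M
    by (rule inj_on_subset) simp
  \<comment> \<open>The gap \<open>?e n\<close> does not depend on \<open>M\<close>, so the
    inequality stays strict when \<open>M\<close> tends to infinity.\<close>
  have bound: "(\<Sum>s<M. \<Sum>j<n. ?t ((j - i) + (i - j)) s) \<le> exp x - ?e n" for M
  proof -
    let ?K = "{..<n + M + 1} \<times> {..<n + M + 1}"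
    \<comment> \<open>The pair \<open>(n, 0)\<close> belongs to order \<open>n\<close>, which the sum does not reach.\<close>
    have sub: "insert (n, 0) (g ` ({..<n} \<times> {..<M})) \<subseteq> ?K"
      using assms(2) by (auto simp: g_def)
    have notin: "(n, 0) \<notin> g ` ({..<n} \<times> {..<M})"
      by (auto simp: g_def)
    have "(\<Sum>s<M. \<Sum>j<n. ?t ((j - i) + (i - j)) s)
        = (\<Sum>p\<in>{..<n} \<times> {..<M}. case g p of (a, b) \<Rightarrow> ?e a * ?e b)"
      by (subst sum.swap) (simp only: term_eq sum.cartesian_product, simp add: case_prod_unfold)
    also have "\<dots> = (\<Sum>(a, b)\<in>g ` ({..<n} \<times> {..<M}). ?e a * ?e b)"
      by (simp add: sum.reindex[OF inj])
    also have "\<dots> + ?e n = (\<Sum>(a, b)\<in>insert (n, 0) (g ` ({..<n} \<times> {..<M})). ?e a * ?e b)"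
      using notin by simp
    also have "\<dots> \<le> (\<Sum>(a, b)\<in>?K. ?e a * ?e b)"
      using sub \<open>y > 0\<close> by (intro sum_mono2) auto
    also have "\<dots> = (\<Sum>a<n + M + 1. ?e a) * (\<Sum>b<n + M + 1. ?e b)"
      by (simp only: sum_product sum.cartesian_product)
    also have "\<dots> \<le> exp y * exp y"
      using \<open>y > 0\<close> by (intro mult_mono sum_power_fact_le_exp sum_nonneg) auto
    also have "\<dots> = exp x"
      by (simp add: y_def flip: exp_add)
    finally show ?thesis by simp
  qed
  have "(\<lambda>s. \<Sum>j<n. ?t ((j - i) + (i - j)) s) sums (\<Sum>j<n. bessel_I ((j - i) + (i - j)) x)"
    unfolding bessel_I_def by (intro sums_sum summable_sums summable_bessel_I)
  then have "(\<Sum>j<n. bessel_I ((j - i) + (i - j)) x) \<le> exp x - ?e n"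
    unfolding sums_def by (rule LIMSEQ_le_const2) (use bound in blast)
  also have "\<dots> < exp x"
    using \<open>y > 0\<close> by simp
  finally show ?thesis .
qed

section \<open>Entries and row sums of \<open>Psi\<close>\<close>

lemma Psi_tridiag_carrier:
  "n \<ge> 1 \<Longrightarrow> Psi d (tridiag n \<mu> (- 2 * \<mu>) \<mu>) \<in> carrier_mat n n"
  unfolding Psi_tridiag by (rule minus_carrier_mat) (simp add: hankel_def v_vec_def Let_def)

lemma Psi_tridiag_entry:
  assumes "i < n" and "j < n"
  defines "h \<equiv> (if i + j < n then i + j else 2 * n - 2 - i - j)"
  shows "Psi d (tridiag n \<mu> (- 2 * \<mu>) \<mu>) $$ (i, j) = exp (- 2 * \<mu>) *
    ((if (j - i) + (i - j) \<le> d then bessel_I ((j - i) + (i - j)) (2 * \<mu>) else 0)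
     - (if h \<le> d then bessel_I (h + 2) (2 * \<mu>) else 0))"
proof -
  have "n \<ge> 1" and "h < n"
    using assms by auto
  have "(if i \<le> j then j - i else i - j) = (j - i) + (i - j)"
    by simp
  then have "toeplitz (u_vec n d \<mu>) $$ (i, j) = exp (- 2 * \<mu>) *
      (if (j - i) + (i - j) \<le> d then bessel_I ((j - i) + (i - j)) (2 * \<mu>) else 0)"
    using assms(1,2) by (simp add: toeplitz_def u_vec_def)
  moreover have "hankel (v_vec n d \<mu>) $$ (i, j) = v_vec n d \<mu> $ h"
    using assms(1,2) unfolding h_def hankel_def Let_def by (simp add: v_vec_def)
  then have "hankel (v_vec n d \<mu>) $$ (i, j) = exp (- 2 * \<mu>) *
      (if h \<le> d then bessel_I (h + 2) (2 * \<mu>) else 0)"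
    using \<open>h < n\<close> by (simp add: v_vec_def)
  moreover have "dim_row (hankel (v_vec n d \<mu>)) = n" "dim_col (hankel (v_vec n d \<mu>)) = n"
    by (simp_all add: hankel_def v_vec_def Let_def)
  ultimately show ?thesis
    using assms(1,2) unfolding Psi_tridiag[OF \<open>n \<ge> 1\<close>] right_diff_distrib by simp
qed

text \<open>The Hankel index is at least the Toeplitz index, so truncation at \<open>d\<close> never
  removes a Toeplitz term while keeping the Hankel term subtracted from it. The upper bound drops
  the Hankel term and undoes the truncation.\<close>

lemma Psi_tridiag_entry_bounds:
  assumes "i < n" and "j < n" and "\<mu> \<ge> 0"
  shows "0 \<le> Psi d (tridiag n \<mu> (- 2 * \<mu>) \<mu>) $$ (i, j)"
    and "Psi d (tridiag n \<mu> (- 2 * \<mu>) \<mu>) $$ (i, j)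
      \<le> exp (- 2 * \<mu>) * bessel_I ((j - i) + (i - j)) (2 * \<mu>)"
proof -
  define m where "m = (j - i) + (i - j)"
  define h where "h = (if i + j < n then i + j else 2 * n - 2 - i - j)"
  \<comment> \<open>The distance from the pair \<open>i\<close>, \<open>j\<close> to a boundary
    node, placed at index -1 in the first case and at \<open>n\<close> in the second; reflection
    there raises the order by \<open>2 * r\<close>.\<close>
  define r where "r = (if i + j < n then min i j + 1 else n - max i j)"
  have h: "h + 2 = m + 2 * r" "m \<le> h"
    using assms(1,2) by (auto simp: m_def h_def r_def min_def max_def)
  have "bessel_I (h + 2) (2 * \<mu>) \<le> bessel_I m (2 * \<mu>)"
    unfolding h using assms(3) by (intro bessel_I_add_even_le) simp
  moreover have nonneg: "bessel_I q (2 * \<mu>) \<ge> 0" for q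
    using assms(3) by (intro bessel_I_nonneg) simp
  ultimately have "0 \<le> (if m \<le> d then bessel_I m (2 * \<mu>) else 0)
      - (if h \<le> d then bessel_I (h + 2) (2 * \<mu>) else 0)"
    using h(2) by auto
  then show "0 \<le> Psi d (tridiag n \<mu> (- 2 * \<mu>) \<mu>) $$ (i, j)"
    unfolding Psi_tridiag_entry[OF assms(1,2)] m_def[symmetric] h_def[symmetric] by simp
  have "(if m \<le> d then bessel_I m (2 * \<mu>) else 0)
      - (if h \<le> d then bessel_I (h + 2) (2 * \<mu>) else 0) \<le> bessel_I m (2 * \<mu>)"
    using nonneg[of m] nonneg[of "h + 2"] by auto
  then show "Psi d (tridiag n \<mu> (- 2 * \<mu>) \<mu>) $$ (i, j)
      \<le> exp (- 2 * \<mu>) * bessel_I ((j - i) + (i - j)) (2 * \<mu>)"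
    unfolding Psi_tridiag_entry[OF assms(1,2)] m_def[symmetric] h_def[symmetric]
    by (intro mult_left_mono) auto
qed

lemma Psi_tridiag_row_sum:
  assumes "i < n" and "\<mu> > 0"
  shows "(\<Sum>j<n. Psi d (tridiag n \<mu> (- 2 * \<mu>) \<mu>) $$ (i, j)) < 1"
proof -
  have "(\<Sum>j<n. Psi d (tridiag n \<mu> (- 2 * \<mu>) \<mu>) $$ (i, j))
      \<le> (\<Sum>j<n. exp (- 2 * \<mu>) * bessel_I ((j - i) + (i - j)) (2 * \<mu>))"
    using assms by (intro sum_mono Psi_tridiag_entry_bounds) auto
  also have "\<dots> = exp (- 2 * \<mu>) * (\<Sum>j<n. bessel_I ((j - i) + (i - j)) (2 * \<mu>))"
    by (simp only: sum_distrib_left)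
  also have "\<dots> < exp (- 2 * \<mu>) * exp (2 * \<mu>)"
    using assms by (intro mult_strict_left_mono sum_bessel_I_less_exp) auto
  also have "\<dots> = 1"
    by (simp flip: exp_add)
  finally show ?thesis .
qed

section \<open>Nonnegative matrices with bounded row sums\<close>

lemma method_step_carrier:
  assumes "Psi d T \<in> carrier_mat n n" and "U \<in> carrier_vec n"
  shows "method_step d T U k \<in> carrier_vec n"
  using assms by (induction k) auto

lemma abs_le_linf_norm:
  assumes "i < dim_vec v"
  shows "\<bar>v $ i\<bar> \<le> linf_norm v"
  unfolding linf_norm_def using assms by (intro Max_ge) auto

lemma linf_norm_less_iff:
  assumes "dim_vec v > 0"
  shows "linf_norm v < c \<longleftrightarrow> (\<forall>i < dim_vec v. \<bar>v $ i\<bar> < c)"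
  unfolding linf_norm_def using assms by (subst Max_less_iff) auto

lemma mult_mat_vec_index_sum:
  assumes "A \<in> carrier_mat n n" and "u \<in> carrier_vec n" and "i < n"
  shows "(A *\<^sub>v u) $ i = (\<Sum>j<n. A $$ (i, j) * u $ j)"
  using assms by (simp add: scalar_prod_def atLeast0LessThan)

text \<open>The entry is a convex combination of the entries of \<open>u\<close> and of 0, which
  carries the mass missing from the row; hence the sign condition on \<open>c\<close>.\<close>

lemma substochastic_mult_le:
  fixes A :: "real mat" and u :: "real vec"
  assumes "A \<in> carrier_mat n n" and "u \<in> carrier_vec n" and "i < n"
    and nonneg: "\<And>j. j < n \<Longrightarrow> 0 \<le> A $$ (i, j)"
    and row: "(\<Sum>j<n. A $$ (i, j)) \<le> 1"
    and "c \<ge> 0" and le: "\<And>j. j < n \<Longrightarrow> u $ j \<le> c"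
  shows "(A *\<^sub>v u) $ i \<le> c"
proof -
  have "(A *\<^sub>v u) $ i \<le> (\<Sum>j<n. A $$ (i, j) * c)"
    unfolding mult_mat_vec_index_sum[OF assms(1-3)]
    using nonneg le by (intro sum_mono mult_left_mono) auto
  also have "\<dots> = (\<Sum>j<n. A $$ (i, j)) * c"
    by (simp only: sum_distrib_right)
  also have "\<dots> \<le> c"
    using mult_right_mono[OF row \<open>c \<ge> 0\<close>] by simp
  finally show ?thesis .
qed

lemma substochastic_mult_ge:
  fixes A :: "real mat" and u :: "real vec"
  assumes "A \<in> carrier_mat n n" and "u \<in> carrier_vec n" and "i < n"
    and nonneg: "\<And>j. j < n \<Longrightarrow> 0 \<le> A $$ (i, j)"
    and row: "(\<Sum>j<n. A $$ (i, j)) \<le> 1"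
    and "c \<le> 0" and ge: "\<And>j. j < n \<Longrightarrow> c \<le> u $ j"
  shows "c \<le> (A *\<^sub>v u) $ i"
proof -
  have "(A *\<^sub>v (- u)) $ i \<le> - c"
    using assms by (intro substochastic_mult_le[of A n]) auto
  moreover have "(A *\<^sub>v (- u)) $ i = - (A *\<^sub>v u) $ i"
    using assms(1-3) by (simp add: mult_mat_vec_index_sum[of A n] sum_negf)
  ultimately show ?thesis by simp
qed

text \<open>A weak bound on \<open>u\<close> becomes strict because the row sum is below 1 and
  \<open>c\<close> is positive; the result can thus be fed back in at the next step.\<close>

lemma substochastic_abs_mult_less:
  fixes A :: "real mat" and u :: "real vec"
  assumes "A \<in> carrier_mat n n" and "u \<in> carrier_vec n" and "i < n"
    and nonneg: "\<And>j. j < n \<Longrightarrow> 0 \<le> A $$ (i, j)"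
    and row: "(\<Sum>j<n. A $$ (i, j)) < 1"
    and "c > 0" and le: "\<And>j. j < n \<Longrightarrow> \<bar>u $ j\<bar> \<le> c"
  shows "\<bar>(A *\<^sub>v u) $ i\<bar> < c"
proof -
  have "\<bar>(A *\<^sub>v u) $ i\<bar> \<le> (\<Sum>j<n. \<bar>A $$ (i, j) * u $ j\<bar>)"
    unfolding mult_mat_vec_index_sum[OF assms(1-3)] by (rule sum_abs)
  also have "\<dots> \<le> (\<Sum>j<n. A $$ (i, j) * c)"
    using nonneg le by (intro sum_mono) (auto simp: abs_mult intro!: mult_left_mono)
  also have "\<dots> = (\<Sum>j<n. A $$ (i, j)) * c"
    by (simp only: sum_distrib_right)
  also have "\<dots> < c"
    using row \<open>c > 0\<close> by simp
  finally show ?thesis .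
qed

text \<open>For the zero initial vector both norms are 0, so the strict inequality is claimed only
  for nonzero data. The second conjunct is the maximum principle itself, and it covers zero data as
  well.\<close>

theorem theorem5p1:
  fixes n d k :: nat and a \<Delta>t \<Delta>x \<mu> :: real and T :: "real mat" and U\<^sub>0 :: "real vec"
  assumes "n \<ge> 1" and "0 < d" and "d \<le> n - 1"
    and "a > 0" and "\<Delta>t > 0" and "\<Delta>x > 0"
    and "\<mu> = a * \<Delta>t / \<Delta>x ^ 2"
    and "T = tridiag n \<mu> (- 2 * \<mu>) \<mu>"
    and "U\<^sub>0 \<in> carrier_vec n"
    and "k \<ge> 1"
  shows "(U\<^sub>0 \<noteq> 0\<^sub>v n \<longrightarrow> linf_norm (method_step d T U\<^sub>0 k) < linf_norm U\<^sub>0)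
    \<and> within_data_extremes U\<^sub>0 (method_step d T U\<^sub>0 k)"
proof -
  have "\<mu> > 0"
    using assms by simp
  let ?A = "Psi d T"
  let ?U = "method_step d T U\<^sub>0"
  have A: "?A \<in> carrier_mat n n"
    unfolding \<open>T = _\<close> using assms(1) by (rule Psi_tridiag_carrier)
  have U: "?U l \<in> carrier_vec n" for l
    using A assms(9) by (rule method_step_carrier)
  have nonneg: "0 \<le> ?A $$ (i, j)" if "i < n" "j < n" for i j
    unfolding \<open>T = _\<close> using that \<open>\<mu> > 0\<close> by (intro Psi_tridiag_entry_bounds) auto
  have row: "(\<Sum>j<n. ?A $$ (i, j)) < 1" if "i < n" for i
    unfolding \<open>T = _\<close> using that \<open>\<mu> > 0\<close> by (rule Psi_tridiag_row_sum)
  have "linf_norm (?U k) < linf_norm U\<^sub>0" if "U\<^sub>0 \<noteq> 0\<^sub>v n"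
  proof -
    obtain i where i: "i < n" "U\<^sub>0 $ i \<noteq> 0"
      using \<open>U\<^sub>0 \<noteq> 0\<^sub>v n\<close> assms(9) by (metis carrier_vecD eq_vecI index_zero_vec)
    then have pos: "linf_norm U\<^sub>0 > 0"
      using abs_le_linf_norm[of i U\<^sub>0] assms(9) by auto
    \<comment> \<open>The induction starts at the first step: at step 0 only the weak bound by the
      norm holds.\<close>
    have less: "\<bar>?U (Suc l) $ i\<bar> < linf_norm U\<^sub>0" if "i < n" for l i
      using that
    proof (induction l arbitrary: i)
      case 0
      then show ?case
        unfolding method_step.simps
        using abs_le_linf_norm[of _ U\<^sub>0] pos nonneg row A assms(9)
        by (intro substochastic_abs_mult_less) auto
    next
      case (Suc l)
      then show ?case
        unfolding method_step.simps(2)[of d T U\<^sub>0 "Suc l"]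
        using pos nonneg row A U[of "Suc l"]
        by (intro substochastic_abs_mult_less) (auto intro: less_imp_le)
    qed
    have "dim_vec (?U k) = n"
      using U by auto
    \<comment> \<open>\<open>k \<ge> 1\<close> gives \<open>Suc (k - 1) = k\<close>, and
      \<open>n \<ge> 1\<close> makes the maximum range over a nonempty set.\<close>
    with less[of _ "k - 1"] assms(1,10) show ?thesis
      by (simp add: linf_norm_less_iff)
  qed
  moreover have "within_data_extremes U\<^sub>0 (?U k)"
  proof -
    let ?S = "insert 0 (set\<^sub>v U\<^sub>0)"
    have fin: "finite ?S"
      by (simp add: vec_set_def)
    have "Min ?S \<le> ?U l $ i \<and> ?U l $ i \<le> Max ?S" if "i < n" for l i
      using that
    proof (induction l arbitrary: i)
      case 0
      then have "U\<^sub>0 $ i \<in> ?S"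
        using assms(9) by (auto simp: vec_set_def)
      then show ?case
        using fin by simp
    next
      case (Suc l)
      \<comment> \<open>The adjoined boundary value 0 supplies the sign conditions under which row
        sums below 1 preserve both bounds.\<close>
      have "Min ?S \<le> 0" "0 \<le> Max ?S"
        using fin by (auto intro: Min_le Max_ge)
      with Suc show ?case
        using substochastic_mult_le[OF A U[of l], of i "Max ?S"]
          substochastic_mult_ge[OF A U[of l], of i "Min ?S"] nonneg row[of i]
        by (auto simp: less_imp_le)
    qed
    then show ?thesis
      using U[of k] by (auto simp: within_data_extremes_def)
  qed
  ultimately show ?thesis by blast
qed

end
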